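(* Fix an attacker strategy $d\in\mathcal{D}_{\mathrm{k}}$. For $i\in\mathcal{N}$ let $(pg_i^\star,qg_i^\star,kg_i^\star)$ (resp. $(\widehat{pg}_i^\star,\widehat{qg}_i^\star,\widehat{kg}_i^\star)$) be the optimal operator response values of the variables of the distributed generator (DG) at node $i$ computed using nonlinear power flow (NPF) (resp. linear power flow (LPF)). Under the No Reverse Power Flow (NRPF) condition, for every $i\in\mathcal{N}$, $$pg_i^\star=\overline{pg}_i(1-kg_i^\star),\qquad qg_i^\star=\eta_i\,\overline{pg}_i(1-kg_i^\star),$$ $$\widehat{pg}_i^\star=\overline{pg}_i(1-\widehat{kg}_i^\star),\qquad \widehat{qg}_i^\star=\eta_i\,\overline{pg}_i(1-\widehat{kg}_i^\star).$$
   Context: Network. The distribution network is a tree with node set $\mathcal{N}\cup\{0\}$, $\mathrm{N}=|\mathcal{N}|$, rooted at the substation node $0$, and edge set $\mathcal{E}$; $(i,j)\in\mathcal{E}$ means $i$ is the parent of $j$. Line $(i,j)$ has resistance $r_{ij}$ and reactance $x_{ij}$ with $0<r_{ij}\ll1$, $0<x_{ij}\ll1$. Each node $i\in\mathcal{N}$ has a load with nominal demand $\overline{pc}_i,\overline{qc}_i$ and minimum load control parameter $\underline\beta_i$, and a DG with maximum active output $\overline{pg}_i$ and maximum ratio $\eta_i\ge0$ of absolute reactive to active output. Loads (resp. DGs) have lower and upper voltage bounds $\underline{\mathrm{vc}}_i,\overline{\mathrm{vc}}_i$ (resp. $\underline{\mathrm{vg}}_i,\overline{\mathrm{vg}}_i$)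 on squared voltage magnitude; lower bounds are positive. $\nu^{nom}$ is the nominal squared voltage and $\Delta\nu_0$ a given substation voltage drop. Attacker. $\mathcal{D}_{\mathrm{k}}=\{d\in\{0,1\}^{\mathcal{N}}:\sum_{i}d_i\le\mathrm{k}\}$; $d_i=1$ means the DG at $i$ is disrupted. Operator. A response is $u=(\beta,pg,qg,kc,kg)$, where $kc_i=1$ (resp. $kg_i=1$) means the load (resp. DG) at $i$ is disconnected. $\mathcal{U}$ is the set of $u$ such that for all $i\in\mathcal{N}$: $0\le pg_i\le\overline{pg}_i(1-kg_i)$, $-\eta_ipg_i\le qg_i\le\eta_ipg_i$, $kg_i,kc_i\in\{0,1\}$, $(1-kc_i)\underline\beta_i\le\beta_i\le 1-kc_i$. $\mathcal{U}(d)$ is the set of $u\in\mathcal{U}$ with $kg_i\ge d_i$ and $pg_i\le\overline{pg}_i(1-d_i)$ for all $i$. Network states. $x=(pc,qc,p,q,P,Q,\nu,\ell)$. For $u\in\mathcal{U}$, $\mathcal{X}(u)$ is the set of $x$ with $\nu_0=\nu^{nom}-\Delta\nu_0$; for all $i\in\mathcal{N}$: $pc_i=\beta_i\overline{pc}_i$, $qc_i=\beta_i\overline{qc}_i$, $kg_i\ge\underline{\mathrm{vg}}_i-\nu_i$, $kg_i\ge\nu_i-\overline{\mathrm{vg}}_i$, $kc_i\ge\underline{\mathrm{vc}}_i-\nu_i$, $kc_i\ge\nu_i-\overline{\mathrm{vc}}_i$, $p_i=pc_i-pg_i$, $q_i=qc_i-qg_i$; and for all $(i,j)\in\mathcal{E}$: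 $P_{ij}=\sum_{k:(j,k)\in\mathcal{E}}P_{jk}+p_j+r_{ij}\ell_{ij}$, $Q_{ij}=\sum_{k:(j,k)\in\mathcal{E}}Q_{jk}+q_j+x_{ij}\ell_{ij}$, $\nu_j=\nu_i-2r_{ij}P_{ij}-2x_{ij}Q_{ij}+(r_{ij}^2+x_{ij}^2)\ell_{ij}$, $\ell_{ij}\nu_i\ge P_{ij}^2+Q_{ij}^2$ (convex relaxation of the NPF equation $\ell_{ij}\nu_i=P_{ij}^2+Q_{ij}^2$; under NRPF the relaxation is exact, i.e. for fixed net consumption there is a unique NPF solution at which the inequality is tight). $\widehat{\mathcal{X}}(u)$ (LPF) is defined identically except that the last four relations are replaced by $P_{ij}=\sum_{k:(j,k)\in\mathcal{E}}P_{jk}+p_j$, $Q_{ij}=\sum_{k:(j,k)\in\mathcal{E}}Q_{jk}+q_j$, $\nu_j=\nu_i-2(r_{ij}P_{ij}+x_{ij}Q_{ij})$, $\ell_{ij}\nu_i=P_{ij}^2+Q_{ij}^2$. Losses. With $W^{VR},W^{LL},W^{LC}_i,W^{LS}_i\in\mathbb{R}_+$ and $W^{LS}_i\ge W^{LC}_i$, $$L(u,x)=W^{VR}\max_{i\in\mathcal{N}}|\nu^{nom}-\nu_i|+\sum_{i\in\mathcal{N}}W^{LC}_i(1-\beta_i)\overline{pc}_i+\sum_{i\in\mathcal{N}}(W^{LS}_i-W^{LC}_i)kc_i\overline{pc}_i+W^{LL}\sum_{(i,j)\in\mathcal{E}}r_{ij}\ell_{ij},$$ and $\widehat L(u,x)$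 is $L$ without the last (line-loss) term. The optimal operator response using NPF is an optimal solution $u$ of $\min_{u\in\mathcal{U}(d),\,x\in\mathcal{X}(u)}L(u,x)$; using LPF, of $\min_{u\in\mathcal{U}(d),\,x\in\widehat{\mathcal{X}}(u)}\widehat L(u,x)$. NRPF condition: with $\mathcal{N}_i$ the node set of the subtree rooted at $i$ (including $i$), $\sum_{j\in\mathcal{N}_i}p_j\ge0$ and $\sum_{j\in\mathcal{N}_i}q_j\ge0$ for all $i\in\mathcal{N}$. It is assumed that NRPF holds even when all DGs produce maximum output, i.e. $pg_i=\overline{pg}_i$ and $qg_i=\eta_i\overline{pg}_i$ for all $i\in\mathcal{N}$.
   Formalization: Ties make the literal claim false: an optimal response may be taken at maximum; literal for NPF if W^LL>0, or (both) if W^VR>0 with one line at the substation. Assumes ν,ℓ≥0, Δν0≥0, ν0 at most all upper bounds, and NRPF with the optimal response's loads and all DGs at maximum. *)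

theory Defs
  imports Complex_Main
begin

(* Per-line data are functions of the edge (parent, child). *)
record 'a network =
  nodes :: "'a set"
  root :: 'a
  edges :: "('a \<times> 'a) set"
  resist :: "'a \<times> 'a \<Rightarrow> real"
  react :: "'a \<times> 'a \<Rightarrow> real"
  pc_nom :: "'a \<Rightarrow> real"
  qc_nom :: "'a \<Rightarrow> real"
  beta_min :: "'a \<Rightarrow> real"
  pg_max :: "'a \<Rightarrow> real"
  eta :: "'a \<Rightarrow> real"
  vc_lo :: "'a \<Rightarrow> real"
  vc_hi :: "'a \<Rightarrow> real"
  vg_lo :: "'a \<Rightarrow> real"
  vg_hi :: "'a \<Rightarrow> real"
  nu_nom :: real
  nu_drop :: real
  W_VR :: real
  W_LL :: real
  W_LC :: "'a \<Rightarrow> real"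
  W_LS :: "'a \<Rightarrow> real"

record 'a response =
  beta :: "'a \<Rightarrow> real"
  pg :: "'a \<Rightarrow> real"
  qg :: "'a \<Rightarrow> real"
  kc :: "'a \<Rightarrow> real"
  kg :: "'a \<Rightarrow> real"

(* nu and ell are the squared voltage and current magnitudes. *)
record 'a net_state =
  pc :: "'a \<Rightarrow> real"
  qc :: "'a \<Rightarrow> real"
  net_p :: "'a \<Rightarrow> real"
  net_q :: "'a \<Rightarrow> real"
  flow_P :: "'a \<times> 'a \<Rightarrow> real"
  flow_Q :: "'a \<times> 'a \<Rightarrow> real"
  nu :: "'a \<Rightarrow> real"
  ell :: "'a \<times> 'a \<Rightarrow> real"

definition rooted_tree :: "'a set \<Rightarrow> 'a \<Rightarrow> ('a \<times> 'a) set \<Rightarrow> bool" where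
  "rooted_tree N r E \<longleftrightarrow>
     finite N \<and> r \<notin> N \<and> E \<subseteq> insert r N \<times> N \<and>
     (\<forall>j\<in>N. \<exists>!i. (i, j) \<in> E) \<and>
     (\<forall>j\<in>N. (r, j) \<in> E\<^sup>*)"

definition children :: "'a network \<Rightarrow> 'a \<Rightarrow> 'a set" where
  "children G j = {k. (j, k) \<in> edges G}"

definition subtree :: "'a network \<Rightarrow> 'a \<Rightarrow> 'a set" where
  "subtree G i = {j \<in> nodes G. (i, j) \<in> (edges G)\<^sup>*}"

(* The bounds r, x < 1 stand for "much smaller than 1".  The last two voltage
   conditions say that nu_drop is a voltage drop (not a rise) and that the
   substation voltage respects the upper voltage bounds. *)
definition distribution_network :: "'a network \<Rightarrow> bool" where
  "distribution_network G \<longleftrightarrow>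
     nodes G \<noteq> {} \<and> rooted_tree (nodes G) (root G) (edges G) \<and>
     (\<forall>e\<in>edges G. 0 < resist G e \<and> resist G e < 1 \<and> 0 < react G e \<and> react G e < 1) \<and>
     (\<forall>i\<in>nodes G. 0 \<le> pg_max G i \<and> 0 \<le> eta G i \<and>
        0 < vc_lo G i \<and> 0 < vg_lo G i) \<and>
     0 \<le> W_VR G \<and> 0 \<le> W_LL G \<and>
     (\<forall>i\<in>nodes G. 0 \<le> W_LC G i \<and> 0 \<le> W_LS G i \<and> W_LC G i \<le> W_LS G i) \<and>
     0 \<le> nu_drop G \<and>
     (\<forall>i\<in>nodes G. nu_nom G - nu_drop G \<le> vc_hi G i \<and> nu_nom G - nu_drop G \<le> vg_hi G i)"

definition attacks :: "'a network \<Rightarrow> nat \<Rightarrow> ('a \<Rightarrow> real) set" where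
  "attacks G k = {d. (\<forall>i\<in>nodes G. d i \<in> {0, 1}) \<and> (\<Sum>i\<in>nodes G. d i) \<le> real k}"

definition responses :: "'a network \<Rightarrow> 'a response set" where
  "responses G = {u. \<forall>i\<in>nodes G.
     0 \<le> pg u i \<and> pg u i \<le> pg_max G i * (1 - kg u i) \<and>
     - (eta G i * pg u i) \<le> qg u i \<and> qg u i \<le> eta G i * pg u i \<and>
     kg u i \<in> {0, 1} \<and> kc u i \<in> {0, 1} \<and>
     (1 - kc u i) * beta_min G i \<le> beta u i \<and> beta u i \<le> 1 - kc u i}"

definition responses_under :: "'a network \<Rightarrow> ('a \<Rightarrow> real) \<Rightarrow> 'a response set" where
  "responses_under G d = {u \<in> responses G. \<forall>i\<in>nodes G.
     d i \<le> kg u i \<and> pg u i \<le> pg_max G i * (1 - d i)}"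

(* Constraints shared by both power flow models, including the sign constraints
   inherent in squared magnitudes; they also make the relaxed current constraint
   below the (convex) rotated second-order cone. *)
definition common_state :: "'a network \<Rightarrow> 'a response \<Rightarrow> 'a net_state \<Rightarrow> bool" where
  "common_state G u x \<longleftrightarrow>
     nu x (root G) = nu_nom G - nu_drop G \<and>
     (\<forall>i\<in>nodes G.
        pc x i = beta u i * pc_nom G i \<and> qc x i = beta u i * qc_nom G i \<and>
        vg_lo G i - nu x i \<le> kg u i \<and> nu x i - vg_hi G i \<le> kg u i \<and>
        vc_lo G i - nu x i \<le> kc u i \<and> nu x i - vc_hi G i \<le> kc u i \<and>
        net_p x i = pc x i - pg u i \<and> net_q x i = qc x i - qg u i) \<and>
     (\<forall>i\<in>insert (root G) (nodes G). 0 \<le> nu x i) \<and>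
     (\<forall>e\<in>edges G. 0 \<le> ell x e)"

definition npf_states :: "'a network \<Rightarrow> 'a response \<Rightarrow> 'a net_state set" where
  "npf_states G u = {x. common_state G u x \<and>
     (\<forall>(i, j)\<in>edges G.
        flow_P x (i, j) = (\<Sum>k\<in>children G j. flow_P x (j, k)) + net_p x j
          + resist G (i, j) * ell x (i, j) \<and>
        flow_Q x (i, j) = (\<Sum>k\<in>children G j. flow_Q x (j, k)) + net_q x j
          + react G (i, j) * ell x (i, j) \<and>
        nu x j = nu x i - 2 * resist G (i, j) * flow_P x (i, j)
          - 2 * react G (i, j) * flow_Q x (i, j)
          + ((resist G (i, j))\<^sup>2 + (react G (i, j))\<^sup>2) * ell x (i, j) \<and>
        ell x (i, j) * nu x i \<ge> (flow_P x (i, j))\<^sup>2 + (flow_Q x (i, j))\<^sup>2)}"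

definition lpf_states :: "'a network \<Rightarrow> 'a response \<Rightarrow> 'a net_state set" where
  "lpf_states G u = {x. common_state G u x \<and>
     (\<forall>(i, j)\<in>edges G.
        flow_P x (i, j) = (\<Sum>k\<in>children G j. flow_P x (j, k)) + net_p x j \<and>
        flow_Q x (i, j) = (\<Sum>k\<in>children G j. flow_Q x (j, k)) + net_q x j \<and>
        nu x j = nu x i
          - 2 * (resist G (i, j) * flow_P x (i, j) + react G (i, j) * flow_Q x (i, j)) \<and>
        ell x (i, j) * nu x i = (flow_P x (i, j))\<^sup>2 + (flow_Q x (i, j))\<^sup>2)}"

definition lpf_loss :: "'a network \<Rightarrow> 'a response \<Rightarrow> 'a net_state \<Rightarrow> real" where
  "lpf_loss G u x =
     W_VR G * Max ((\<lambda>i. \<bar>nu_nom G - nu x i\<bar>) ` nodes G)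
     + (\<Sum>i\<in>nodes G. W_LC G i * (1 - beta u i) * pc_nom G i)
     + (\<Sum>i\<in>nodes G. (W_LS G i - W_LC G i) * kc u i * pc_nom G i)"

definition npf_loss :: "'a network \<Rightarrow> 'a response \<Rightarrow> 'a net_state \<Rightarrow> real" where
  "npf_loss G u x = lpf_loss G u x + W_LL G * (\<Sum>e\<in>edges G. resist G e * ell x e)"

definition npf_optimal :: "'a network \<Rightarrow> ('a \<Rightarrow> real) \<Rightarrow> 'a response \<Rightarrow> bool" where
  "npf_optimal G d u \<longleftrightarrow> u \<in> responses_under G d \<and>
     (\<exists>x\<in>npf_states G u. \<forall>u'\<in>responses_under G d. \<forall>x'\<in>npf_states G u'.
        npf_loss G u x \<le> npf_loss G u' x')"

definition lpf_optimal :: "'a network \<Rightarrow> ('a \<Rightarrow> real) \<Rightarrow> 'a response \<Rightarrow> bool" where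
  "lpf_optimal G d u \<longleftrightarrow> u \<in> responses_under G d \<and>
     (\<exists>x\<in>lpf_states G u. \<forall>u'\<in>responses_under G d. \<forall>x'\<in>lpf_states G u'.
        lpf_loss G u x \<le> lpf_loss G u' x')"

definition nrpf :: "'a network \<Rightarrow> ('a \<Rightarrow> real) \<Rightarrow> ('a \<Rightarrow> real) \<Rightarrow> bool" where
  "nrpf G p q \<longleftrightarrow> (\<forall>i\<in>nodes G. 0 \<le> (\<Sum>j\<in>subtree G i. p j) \<and> 0 \<le> (\<Sum>j\<in>subtree G i. q j))"

(* No reverse power flow for the load consumption of u, even if all DGs were at
   maximum output.  It is a condition on u: demanding it of every response would
   include shedding all loads, which forces pg_max = 0. *)
definition nrpf_at_max_dg :: "'a network \<Rightarrow> 'a response \<Rightarrow> bool" where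
  "nrpf_at_max_dg G u \<longleftrightarrow>
     nrpf G (\<lambda>i. beta u i * pc_nom G i - pg_max G i)
            (\<lambda>i. beta u i * qc_nom G i - eta G i * pg_max G i)"

definition dg_at_max_output :: "'a network \<Rightarrow> 'a response \<Rightarrow> bool" where
  "dg_at_max_output G u \<longleftrightarrow> (\<forall>i\<in>nodes G.
     pg u i = pg_max G i * (1 - kg u i) \<and>
     qg u i = eta G i * pg_max G i * (1 - kg u i))"

(* When W_VR > 0 and a single line leaves the root, every DG influences the
   voltage at every node, hence the voltage regulation term. *)
definition voltage_sensitive :: "'a network \<Rightarrow> bool" where
  "voltage_sensitive G \<longleftrightarrow> 0 < W_VR G \<and> (\<exists>!j. (root G, j) \<in> edges G)"

end

(* Given an optimal response u with power flow x, raise all connected DGs to maximum output and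
   keep the loads and connections.  Keeping the currents ell of x and recomputing flows and
   voltages along the tree lowers all flows, which stay nonnegative by NRPF, and raises all
   voltages, which stay below the substation voltage; hence the relaxed current constraint is
   preserved, and the voltage regulation term does not grow.  (For LPF the same comparison applies
   to the lossless flow equations.)  If some DG was below maximum, the current constraint on the line
   feeding it becomes slack, so that current can be reduced and the line losses decrease strictly;
   and with a single line at the root every voltage rises strictly. *)
theory Submission
  imports Defs
begin

text \<open>The current \<open>l\<close> is a parameter, so one comparison serves both models:
  \<open>l = ell x\<close> gives the NPF equations and \<open>l = 0\<close> the lossless LPF ones.
  The constraints tying current to flows and voltage are left out, since they differ between the
  models.\<close>

definition branch_flow ::
  "'a network \<Rightarrow> ('a \<Rightarrow> real) \<Rightarrow> ('a \<Rightarrow> real) \<Rightarrow> ('a \<times> 'a \<Rightarrow> real) \<Rightarrow>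
   ('a \<times> 'a \<Rightarrow> real) \<Rightarrow> ('a \<times> 'a \<Rightarrow> real) \<Rightarrow> ('a \<Rightarrow> real) \<Rightarrow> bool" where
  "branch_flow G p q l P Q v \<longleftrightarrow> (\<forall>(i, j)\<in>edges G.
     P (i, j) = (\<Sum>k\<in>children G j. P (j, k)) + p j + resist G (i, j) * l (i, j) \<and>
     Q (i, j) = (\<Sum>k\<in>children G j. Q (j, k)) + q j + react G (i, j) * l (i, j) \<and>
     v j = v i - 2 * resist G (i, j) * P (i, j) - 2 * react G (i, j) * Q (i, j)
       + ((resist G (i, j))\<^sup>2 + (react G (i, j))\<^sup>2) * l (i, j))"

lemma npf_states_iff:
  "x \<in> npf_states G u \<longleftrightarrow> common_state G u x \<and>
     branch_flow G (net_p x) (net_q x) (ell x) (flow_P x) (flow_Q x) (nu x) \<and>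
     (\<forall>(i, j)\<in>edges G. (flow_P x (i, j))\<^sup>2 + (flow_Q x (i, j))\<^sup>2 \<le> ell x (i, j) * nu x i)"
  unfolding npf_states_def branch_flow_def by fastforce

lemma lpf_states_iff:
  "x \<in> lpf_states G u \<longleftrightarrow> common_state G u x \<and>
     branch_flow G (net_p x) (net_q x) (\<lambda>_. 0) (flow_P x) (flow_Q x) (nu x) \<and>
     (\<forall>(i, j)\<in>edges G. ell x (i, j) * nu x i = (flow_P x (i, j))\<^sup>2 + (flow_Q x (i, j))\<^sup>2)"
  unfolding lpf_states_def branch_flow_def by (fastforce simp: algebra_simps)

section \<open>Tree structure: parents, acyclicity and ancestors\<close>

locale radial_network =
  fixes G :: "'a network"
  assumes network: "distribution_network G"
begin

abbreviation N where "N \<equiv> nodes G"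
abbreviation E where "E \<equiv> edges G"

lemma
  shows finite_nodes: "finite N" and nodes_nonempty: "N \<noteq> {}"
    and root_not_node: "root G \<notin> N"
    and edges_subset: "E \<subseteq> insert (root G) N \<times> N"
    and ex1_parent: "j \<in> N \<Longrightarrow> \<exists>!i. (i, j) \<in> E"
    and root_reaches: "j \<in> N \<Longrightarrow> (root G, j) \<in> E\<^sup>*"
    and resist_pos: "e \<in> E \<Longrightarrow> 0 < resist G e"
    and react_pos: "e \<in> E \<Longrightarrow> 0 < react G e"
  using network unfolding distribution_network_def rooted_tree_def by blast+

lemma edge_target: "(i, j) \<in> E \<Longrightarrow> j \<in> N"
  using edges_subset by blast

lemma parent_unique: "(i, j) \<in> E \<Longrightarrow> (i', j) \<in> E \<Longrightarrow> i = i'"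
  using ex1_parent edge_target by blast

text \<open>On \<open>N\<close> this identifies a node with the line feeding it, so line quantities
  can be summed over nodes. Outside \<open>N\<close>, in particular at the root, the value is
  arbitrary.\<close>

definition parent :: "'a \<Rightarrow> 'a" where "parent j = (THE i. (i, j) \<in> E)"

lemma parent_eq: "(i, j) \<in> E \<Longrightarrow> parent j = i"
  unfolding parent_def using parent_unique by blast

lemma parent_edge: "j \<in> N \<Longrightarrow> (parent j, j) \<in> E"
  using ex1_parent parent_eq by blast

lemma finite_edges: "finite E"
  using finite_subset[OF edges_subset] finite_nodes by simp

lemma reach_node: "(i, j) \<in> E\<^sup>* \<Longrightarrow> i \<in> N \<Longrightarrow> j \<in> N"
  by (induction rule: rtrancl_induct) (auto dest: edge_target)

text \<open>Acyclicity follows from reachability and unique parents. A cycle through a node must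
  enter it from its parent and hence also passes through the parent; going up a path from the root,
  it would reach the root, which has no incoming edge.\<close>

lemma no_cycle: "(j, j) \<notin> E\<^sup>+"
proof
  assume cyc: "(j, j) \<in> E\<^sup>+"
  have "(root G, k) \<in> E\<^sup>* \<Longrightarrow> (k, k) \<notin> E\<^sup>+" for k
  proof (induction rule: rtrancl_induct)
    case base
    show ?case by (metis tranclE edge_target root_not_node)
  next
    case (step i k)
    show ?case
    proof
      assume "(k, k) \<in> E\<^sup>+"
      then obtain m where "(k, m) \<in> E\<^sup>*" "(m, k) \<in> E" by (meson tranclD2)
      with step show False by (metis parent_unique rtrancl_into_trancl2)
    qed
  qed
  moreover have "j \<in> N" using cyc by (metis tranclE edge_target)
  ultimately show False using cyc root_reaches by blast
qed

lemma acyclic_edges: "acyclic E"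
  using no_cycle by (simp add: acyclic_def)

text \<open>For a node, the node itself is included and the root is not, so the elements correspond
  to the lines on the path from the root. Sums over this set accumulate voltage changes along that
  path.\<close>

definition ancestors :: "'a \<Rightarrow> 'a set" where
  "ancestors j = {a \<in> N. (a, j) \<in> E\<^sup>*}"

lemma finite_ancestors: "finite (ancestors j)"
  unfolding ancestors_def using finite_nodes by simp

lemma ancestors_root: "ancestors (root G) = {}"
  unfolding ancestors_def using root_not_node by (auto dest: reach_node)

lemma
  assumes e: "(i, j) \<in> E"
  shows ancestors_edge: "ancestors j = insert j (ancestors i)"
    and not_ancestor_of_parent: "j \<notin> ancestors i"
proof -
  show "ancestors j = insert j (ancestors i)"
    unfolding ancestors_def
    using e edge_target parent_unique by (blast elim: rtranclE intro: rtrancl_into_rtrancl)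
  show "j \<notin> ancestors i"
    unfolding ancestors_def using no_cycle[of j] e by (auto intro: rtrancl_into_trancl1)
qed

section \<open>Subtrees, and flows as sums over them\<close>

lemma finite_subtree: "finite (subtree G j)"
  unfolding subtree_def using finite_nodes by simp

lemma subtree_self: "j \<in> N \<Longrightarrow> j \<in> subtree G j"
  unfolding subtree_def by simp

lemma subtree_nodes: "subtree G j \<subseteq> N"
  unfolding subtree_def by auto

lemma finite_children: "finite (children G j)"
proof -
  have "children G j \<subseteq> N" by (auto simp: children_def dest: edge_target)
  then show ?thesis by (rule finite_subset) (rule finite_nodes)
qed

lemma subtree_unfold:
  assumes "j \<in> N"
  shows "subtree G j = insert j (\<Union>k\<in>children G j. subtree G k)"
  unfolding subtree_def children_def
  using assms by (auto elim: converse_rtranclE intro: converse_rtrancl_into_rtrancl)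

text \<open>A nontrivial path from \<open>k\<close> to \<open>k'\<close> would enter
  \<open>k'\<close> through the common parent \<open>j\<close> and close a cycle with the edge from
  \<open>j\<close> to \<open>k\<close>.\<close>

lemma siblings_unreachable:
  assumes "(j, k) \<in> E" "(j, k') \<in> E" "(k, k') \<in> E\<^sup>*"
  shows "k = k'"
  using assms(3)
proof (cases rule: rtranclE)
  case (step m)
  then have "(k, j) \<in> E\<^sup>*" using parent_unique assms(2) by blast
  then show ?thesis using no_cycle[of j] assms(1) by (meson rtrancl_into_trancl2)
qed

text \<open>The reversed edge relation is single-valued, so two nodes that both reach
  \<open>m\<close> lie on one chain and one reaches the other, which is impossible for distinct
  siblings.\<close>

lemma subtree_disjoint:
  assumes "(j, k) \<in> E" "(j, k') \<in> E" "k \<noteq> k'"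
  shows "subtree G k \<inter> subtree G k' = {}"
proof (rule ccontr)
  assume "subtree G k \<inter> subtree G k' \<noteq> {}"
  then obtain m where "(k, m) \<in> E\<^sup>*" "(k', m) \<in> E\<^sup>*" unfolding subtree_def by auto
  then have "(m, k) \<in> (E\<inverse>)\<^sup>*" "(m, k') \<in> (E\<inverse>)\<^sup>*" by (simp_all add: rtrancl_converse)
  moreover have "single_valued (E\<inverse>)"
    by (rule single_valuedI) (auto dest: parent_unique)
  ultimately have "(k, k') \<in> (E\<inverse>)\<^sup>* \<or> (k', k) \<in> (E\<inverse>)\<^sup>*"
    by (metis single_valued_confluent)
  then have "(k', k) \<in> E\<^sup>* \<or> (k, k') \<in> E\<^sup>*" by (simp add: rtrancl_converse)
  then show False using siblings_unreachable assms by metis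
qed

lemma sum_subtree:
  fixes f :: "'a \<Rightarrow> real"
  assumes "j \<in> N"
  shows "sum f (subtree G j) = f j + (\<Sum>k\<in>children G j. sum f (subtree G k))"
proof -
  have "j \<notin> (\<Union>k\<in>children G j. subtree G k)"
    unfolding children_def subtree_def using no_cycle[of j]
    by (auto intro: rtrancl_into_trancl2)
  moreover have "sum f (\<Union>k\<in>children G j. subtree G k) = (\<Sum>k\<in>children G j. sum f (subtree G k))"
    using finite_children finite_subtree subtree_disjoint
    by (intro sum.UNION_disjoint) (simp_all add: children_def)
  ultimately show ?thesis
    by (simp add: subtree_unfold[OF assms] finite_children finite_subtree)
qed

text \<open>Both sides obey the same recursion over children. The induction runs from the leaves
  upwards; it is well-founded because the edge relation is finite and acyclic.\<close>

lemma flow_eq_sum_subtree: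
  fixes F :: "'a \<times> 'a \<Rightarrow> real"
  assumes "\<And>i j. (i, j) \<in> E \<Longrightarrow> F (i, j) = (\<Sum>k\<in>children G j. F (j, k)) + w j"
    and "(i, j) \<in> E"
  shows "F (i, j) = sum w (subtree G j)"
proof -
  have "wf (E\<inverse>)" using finite_acyclic_wf_converse finite_edges acyclic_edges by blast
  then show ?thesis using assms(2)
  proof (induction j arbitrary: i rule: wf_induct_rule)
    case (less j)
    have "(\<Sum>k\<in>children G j. F (j, k)) = (\<Sum>k\<in>children G j. sum w (subtree G k))"
      by (rule sum.cong) (auto simp: children_def less.IH)
    then show ?case
      using assms(1)[OF less.prems] sum_subtree[OF edge_target[OF less.prems], of w] by simp
  qed
qed

lemma branch_flow_eq_sum_subtree:
  assumes "branch_flow G p q l P Q v" "(i, j) \<in> E"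
  shows "P (i, j) = (\<Sum>k\<in>subtree G j. p k + resist G (parent k, k) * l (parent k, k))"
    and "Q (i, j) = (\<Sum>k\<in>subtree G j. q k + react G (parent k, k) * l (parent k, k))"
  using assms
  by (auto simp: branch_flow_def parent_eq intro!: flow_eq_sum_subtree)

section \<open>Comparison of two flows on the same tree\<close>

lemma sum_subtree_ge:
  fixes f :: "'a \<Rightarrow> real"
  assumes "\<And>k. k \<in> N \<Longrightarrow> 0 \<le> f k" and "i \<in> subtree G j"
  shows "f i \<le> sum f (subtree G j)"
  using assms subtree_nodes by (intro member_le_sum) (auto simp: finite_subtree)

text \<open>Flows are determined by consumption and currents as subtree sums, so lowering both
  lowers all flows. The new voltages are then fixed by the root voltage and rise along with this.
  NRPF keeps the new flows nonnegative and hence the new voltages below the root voltage.\<close>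

lemma branch_flow_compare:
  assumes flow: "branch_flow G p q l P Q v"
    and p: "\<And>j. j \<in> N \<Longrightarrow> p' j \<le> p j" and q: "\<And>j. j \<in> N \<Longrightarrow> q' j \<le> q j"
    and l: "\<And>e. e \<in> E \<Longrightarrow> 0 \<le> l' e" "\<And>e. e \<in> E \<Longrightarrow> l' e \<le> l e"
    and nrpf: "nrpf G p' q'"
  obtains P' Q' v' where "branch_flow G p' q' l' P' Q' v'"
    and "v' (root G) = v (root G)"
    and "\<And>e. e \<in> E \<Longrightarrow> 0 \<le> P' e \<and> P' e \<le> P e \<and> 0 \<le> Q' e \<and> Q' e \<le> Q e"
    and "\<And>j. j \<in> insert (root G) N \<Longrightarrow> v j \<le> v' j \<and> v' j \<le> v (root G)"
    and "\<And>a b i. (a, b) \<in> E \<Longrightarrow> (b, i) \<in> E\<^sup>* \<Longrightarrow> p' i < p i \<or> q' i < q i \<Longrightarrow>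
      (P' (a, b) < P (a, b) \<or> Q' (a, b) < Q (a, b)) \<and> (\<forall>j. (b, j) \<in> E\<^sup>* \<longrightarrow> v j < v' j)"
proof -
  let ?e = "\<lambda>j. (parent j, j)"
  define loss_r where "loss_r m j = resist G (?e j) * m (?e j)" for m :: "'a \<times> 'a \<Rightarrow> real" and j
  define loss_x where "loss_x m j = react G (?e j) * m (?e j)" for m :: "'a \<times> 'a \<Rightarrow> real" and j
  define P' where "P' = (\<lambda>(i :: 'a, j). \<Sum>k\<in>subtree G j. p' k + loss_r l' k)"
  define Q' where "Q' = (\<lambda>(i :: 'a, j). \<Sum>k\<in>subtree G j. q' k + loss_x l' k)"
  \<comment> \<open>\<open>D j\<close> is the amount by which the voltage drop over the line into
    \<open>j\<close> shrinks. Adding these amounts along the path from the root makes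
    \<open>v'\<close> satisfy the voltage equation by construction.\<close>
  define D where "D j = 2 * resist G (?e j) * (P (?e j) - P' (?e j))
      + 2 * react G (?e j) * (Q (?e j) - Q' (?e j))
      - ((resist G (?e j))\<^sup>2 + (react G (?e j))\<^sup>2) * (l (?e j) - l' (?e j))" for j
  define v' where "v' j = v j + sum D (ancestors j)" for j
  define A where "A j = (\<Sum>k\<in>subtree G j. p k - p' k)" for j
  define B where "B j = (\<Sum>k\<in>subtree G j. q k - q' k)" for j

  have r0: "0 \<le> resist G (?e j)" and x0: "0 \<le> react G (?e j)" if "j \<in> N" for j
    using that resist_pos react_pos parent_edge less_imp_le by blast+
  \<comment> \<open>Of all the loss reductions in the subtree only that of the line itself is kept;
    the bound on \<open>D\<close> relies on this term.\<close>
  have dP: "A j + resist G (i, j) * (l (i, j) - l' (i, j)) \<le> P (i, j) - P' (i, j)"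
    and dQ: "B j + react G (i, j) * (l (i, j) - l' (i, j)) \<le> Q (i, j) - Q' (i, j)"
    if e: "(i, j) \<in> E" for i j
  proof -
    have "P (i, j) - P' (i, j) = A j + (\<Sum>k\<in>subtree G j. loss_r (\<lambda>e. l e - l' e) k)"
      unfolding branch_flow_eq_sum_subtree(1)[OF flow e] P'_def A_def loss_r_def
      by (simp add: sum_subtractf sum.distrib right_diff_distrib)
    moreover have "loss_r (\<lambda>e. l e - l' e) j \<le> (\<Sum>k\<in>subtree G j. loss_r (\<lambda>e. l e - l' e) k)"
      by (rule sum_subtree_ge)
        (use e edge_target in \<open>auto simp: loss_r_def r0 l parent_edge subtree_self\<close>)
    ultimately show "A j + resist G (i, j) * (l (i, j) - l' (i, j)) \<le> P (i, j) - P' (i, j)"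
      using parent_eq[OF e] by (simp add: loss_r_def)
    have "Q (i, j) - Q' (i, j) = B j + (\<Sum>k\<in>subtree G j. loss_x (\<lambda>e. l e - l' e) k)"
      unfolding branch_flow_eq_sum_subtree(2)[OF flow e] Q'_def B_def loss_x_def
      by (simp add: sum_subtractf sum.distrib right_diff_distrib)
    moreover have "loss_x (\<lambda>e. l e - l' e) j \<le> (\<Sum>k\<in>subtree G j. loss_x (\<lambda>e. l e - l' e) k)"
      by (rule sum_subtree_ge)
        (use e edge_target in \<open>auto simp: loss_x_def x0 l parent_edge subtree_self\<close>)
    ultimately show "B j + react G (i, j) * (l (i, j) - l' (i, j)) \<le> Q (i, j) - Q' (i, j)"
      using parent_eq[OF e] by (simp add: loss_x_def)
  qed
  \<comment> \<open>By NRPF the net consumption of the subtree is nonnegative, so the flow covers at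
    least the loss on its own line.\<close>
  have P'_ge: "resist G (i, j) * l' (i, j) \<le> P' (i, j)"
    and Q'_ge: "react G (i, j) * l' (i, j) \<le> Q' (i, j)" if e: "(i, j) \<in> E" for i j
  proof -
    have "loss_r l' j \<le> (\<Sum>k\<in>subtree G j. loss_r l' k)"
      by (rule sum_subtree_ge)
        (use e edge_target in \<open>auto simp: loss_r_def r0 l parent_edge subtree_self\<close>)
    moreover have "loss_x l' j \<le> (\<Sum>k\<in>subtree G j. loss_x l' k)"
      by (rule sum_subtree_ge)
        (use e edge_target in \<open>auto simp: loss_x_def x0 l parent_edge subtree_self\<close>)
    moreover have "0 \<le> sum p' (subtree G j)" "0 \<le> sum q' (subtree G j)"
      using nrpf edge_target[OF e] unfolding nrpf_def by blast+
    ultimately show "resist G (i, j) * l' (i, j) \<le> P' (i, j)"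
      and "react G (i, j) * l' (i, j) \<le> Q' (i, j)"
      using parent_eq[OF e] by (simp_all add: P'_def Q'_def sum.distrib loss_r_def loss_x_def)
  qed
  have A0: "0 \<le> A j" and B0: "0 \<le> B j" for j
    unfolding A_def B_def using p q subtree_nodes by (fastforce intro!: sum_nonneg)+
  \<comment> \<open>A lower current by itself reduces the voltage at \<open>j\<close> by
    \<open>(?r^2 + ?x^2) * ?d\<close>, but the lower loss on the same line raises it by at least
    twice that amount.\<close>
  have D_ge: "2 * resist G (?e j) * A j + 2 * react G (?e j) * B j \<le> D j" if "j \<in> N" for j
  proof -
    let ?r = "resist G (?e j)" and ?x = "react G (?e j)" and ?d = "l (?e j) - l' (?e j)"
    note e = parent_edge[OF that]
    have "2 * ?r * (A j + ?r * ?d) \<le> 2 * ?r * (P (?e j) - P' (?e j))"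
      by (rule mult_left_mono[OF dP[OF e]]) (simp add: r0 that)
    moreover have "2 * ?x * (B j + ?x * ?d) \<le> 2 * ?x * (Q (?e j) - Q' (?e j))"
      by (rule mult_left_mono[OF dQ[OF e]]) (simp add: x0 that)
    moreover have "0 \<le> (?r\<^sup>2 + ?x\<^sup>2) * ?d" using l(2)[OF e] by simp
    ultimately show ?thesis unfolding D_def by (simp add: algebra_simps power2_eq_square)
  qed
  have D0: "0 \<le> D j" if "j \<in> N" for j
    using D_ge[OF that] r0[OF that] x0[OF that] A0[of j] B0[of j]
    by (smt (verit) mult_nonneg_nonneg)

  have flow': "branch_flow G p' q' l' P' Q' v'"
    unfolding branch_flow_def
  proof (intro ballI, clarify)
    fix i j assume e: "(i, j) \<in> E"
    note j = edge_target[OF e] and pe = parent_eq[OF e]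
    have "v j = v i - 2 * resist G (i, j) * P (i, j) - 2 * react G (i, j) * Q (i, j)
       + ((resist G (i, j))\<^sup>2 + (react G (i, j))\<^sup>2) * l (i, j)"
      using flow e unfolding branch_flow_def by blast
    moreover have "sum D (ancestors j) = D j + sum D (ancestors i)"
      using ancestors_edge[OF e] not_ancestor_of_parent[OF e] finite_ancestors by simp
    ultimately have "v' j = v' i - 2 * resist G (i, j) * P' (i, j) - 2 * react G (i, j) * Q' (i, j)
       + ((resist G (i, j))\<^sup>2 + (react G (i, j))\<^sup>2) * l' (i, j)"
      unfolding v'_def D_def pe by (simp add: algebra_simps)
    moreover have
      "P' (i, j) = (\<Sum>k\<in>children G j. P' (j, k)) + p' j + resist G (i, j) * l' (i, j)"
      "Q' (i, j) = (\<Sum>k\<in>children G j. Q' (j, k)) + q' j + react G (i, j) * l' (i, j)"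
      using sum_subtree[OF j, of "\<lambda>k. p' k + loss_r l' k"]
        sum_subtree[OF j, of "\<lambda>k. q' k + loss_x l' k"]
      by (simp_all add: P'_def Q'_def loss_r_def loss_x_def pe)
    ultimately show
      "P' (i, j) = (\<Sum>k\<in>children G j. P' (j, k)) + p' j + resist G (i, j) * l' (i, j) \<and>
       Q' (i, j) = (\<Sum>k\<in>children G j. Q' (j, k)) + q' j + react G (i, j) * l' (i, j) \<and>
       v' j = v' i - 2 * resist G (i, j) * P' (i, j) - 2 * react G (i, j) * Q' (i, j)
         + ((resist G (i, j))\<^sup>2 + (react G (i, j))\<^sup>2) * l' (i, j)"
      by blast
  qed
  have root': "v' (root G) = v (root G)" by (simp add: v'_def ancestors_root)
  have bounds: "0 \<le> P' e \<and> P' e \<le> P e \<and> 0 \<le> Q' e \<and> Q' e \<le> Q e" if "e \<in> E" for e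
  proof (cases e)
    case (Pair i j)
    then have e: "(i, j) \<in> E" using that by simp
    have "0 \<le> resist G (i, j) * l' (i, j)" "0 \<le> react G (i, j) * l' (i, j)"
      "0 \<le> resist G (i, j) * (l (i, j) - l' (i, j))"
      "0 \<le> react G (i, j) * (l (i, j) - l' (i, j))"
      using l[OF e] resist_pos[OF e] react_pos[OF e] by simp_all
    then show ?thesis
      using Pair dP[OF e] dQ[OF e] P'_ge[OF e] Q'_ge[OF e] A0[of j] B0[of j] by auto
  qed
  have v_le: "v j \<le> v' j" for j
    unfolding v'_def using D0 by (auto intro!: sum_nonneg simp: ancestors_def)
  have "v' j \<le> v (root G)" if "(root G, j) \<in> E\<^sup>*" for j
    using that
  proof (induction rule: rtrancl_induct)
    case base
    show ?case using root' by simp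
  next
    case (step i j)
    let ?r = "resist G (i, j)" and ?x = "react G (i, j)"
    have "v' j = v' i - 2 * ?r * P' (i, j) - 2 * ?x * Q' (i, j) + (?r\<^sup>2 + ?x\<^sup>2) * l' (i, j)"
      using flow' step(2) unfolding branch_flow_def by blast
    \<comment> \<open>One half of the drop caused by the flows offsets the quadratic current term;
      the other half is nonnegative. So voltage never rises away from the root.\<close>
    moreover have "?r * (?r * l' (i, j)) \<le> ?r * P' (i, j)" "?x * (?x * l' (i, j)) \<le> ?x * Q' (i, j)"
      using P'_ge Q'_ge step(2) resist_pos react_pos by (simp_all add: mult_left_mono)
    moreover have "0 \<le> ?r * P' (i, j)" "0 \<le> ?x * Q' (i, j)"
      using bounds[OF step(2)] resist_pos[OF step(2)] react_pos[OF step(2)] by simp_all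
    ultimately have "v' j \<le> v' i" by (simp add: algebra_simps power2_eq_square)
    then show ?case using step.IH by simp
  qed
  then have v_bounds: "v j \<le> v' j \<and> v' j \<le> v (root G)" if "j \<in> insert (root G) N" for j
    using that v_le root_reaches by auto
  \<comment> \<open>A strict decrease of consumption below \<open>b\<close> makes \<open>A b\<close>
    or \<open>B b\<close> positive. As resistance and reactance are both positive, so is
    \<open>D b\<close>, and this increment enters the voltage of every node below
    \<open>b\<close>.\<close>
  have strict: "(P' (a, b) < P (a, b) \<or> Q' (a, b) < Q (a, b)) \<and> (\<forall>j. (b, j) \<in> E\<^sup>* \<longrightarrow> v j < v' j)"
    if e: "(a, b) \<in> E" and reach: "(b, i) \<in> E\<^sup>*" and less: "p' i < p i \<or> q' i < q i" for a b i
  proof -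
    note b = edge_target[OF e] and pe = parent_eq[OF e]
    have i: "i \<in> subtree G b" using reach b reach_node by (auto simp: subtree_def)
    have "p i - p' i \<le> A b" "q i - q' i \<le> B b"
      unfolding A_def B_def using p q i by (auto intro!: sum_subtree_ge[where f = "\<lambda>k. _ k - _ k"])
    then have AB: "0 < A b \<or> 0 < B b" using less by auto
    have "0 \<le> resist G (a, b) * (l (a, b) - l' (a, b))"
      "0 \<le> react G (a, b) * (l (a, b) - l' (a, b))"
      using l[OF e] resist_pos[OF e] react_pos[OF e] by simp_all
    then have PQ: "P' (a, b) < P (a, b) \<or> Q' (a, b) < Q (a, b)"
      using dP[OF e] dQ[OF e] AB by auto
    have "0 < 2 * resist G (a, b) * A b + 2 * react G (a, b) * B b"
      using AB A0[of b] B0[of b] resist_pos[OF e] react_pos[OF e]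
      by (auto intro: add_pos_nonneg add_nonneg_pos)
    then have Db: "0 < D b" using D_ge[OF b] pe by simp
    have "v j < v' j" if "(b, j) \<in> E\<^sup>*" for j
    proof -
      have "D b \<le> sum D (ancestors j)"
        using that b D0 finite_ancestors by (intro member_le_sum) (auto simp: ancestors_def)
      then show ?thesis using Db by (simp add: v'_def)
    qed
    with PQ show ?thesis by blast
  qed
  show thesis by (rule that[OF flow' root' bounds v_bounds strict])
qed

section \<open>Responses with every connected DG at maximum output\<close>

definition saturate :: "'a response \<Rightarrow> 'a response" where
  "saturate u = u\<lparr>pg := \<lambda>i. pg_max G i * (1 - kg u i),
                  qg := \<lambda>i. eta G i * pg_max G i * (1 - kg u i)\<rparr>"

lemma saturate_simps [simp]:
  "beta (saturate u) = beta u" "kc (saturate u) = kc u" "kg (saturate u) = kg u"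
  "pg (saturate u) i = pg_max G i * (1 - kg u i)"
  "qg (saturate u) i = eta G i * pg_max G i * (1 - kg u i)"
  "saturate (saturate u) = saturate u"
  by (simp_all add: saturate_def)

lemma dg_at_max_saturate: "dg_at_max_output G (saturate u)"
  by (simp add: dg_at_max_output_def)

lemma pg_max_nonneg: "i \<in> N \<Longrightarrow> 0 \<le> pg_max G i"
  and eta_nonneg: "i \<in> N \<Longrightarrow> 0 \<le> eta G i"
  using network unfolding distribution_network_def by blast+

lemma saturate_ge:
  assumes "u \<in> responses G" "i \<in> N"
  shows "pg u i \<le> pg (saturate u) i" "qg u i \<le> qg (saturate u) i"
proof -
  show pg: "pg u i \<le> pg (saturate u) i" using assms unfolding responses_def by simp
  have "qg u i \<le> eta G i * pg u i" using assms unfolding responses_def by blast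
  also have "\<dots> \<le> eta G i * pg (saturate u) i"
    using pg eta_nonneg[OF assms(2)] by (rule mult_left_mono)
  finally show "qg u i \<le> qg (saturate u) i" by (simp add: mult.assoc)
qed

lemma saturate_in_responses:
  assumes "u \<in> responses G"
  shows "saturate u \<in> responses G"
  unfolding responses_def
proof (intro CollectI ballI)
  fix i assume i: "i \<in> N"
  have u: "kg u i \<in> {0, 1}" "kc u i \<in> {0, 1}"
    "(1 - kc u i) * beta_min G i \<le> beta u i" "beta u i \<le> 1 - kc u i"
    using assms i unfolding responses_def by blast+
  then have pg: "0 \<le> pg_max G i * (1 - kg u i)" using pg_max_nonneg[OF i] by auto
  then have "0 \<le> eta G i * (pg_max G i * (1 - kg u i))" using eta_nonneg[OF i] by simp
  with pg u show "0 \<le> pg (saturate u) i \<and> pg (saturate u) i \<le> pg_max G i * (1 - kg (saturate u) i) \<and>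
     - (eta G i * pg (saturate u) i) \<le> qg (saturate u) i \<and>
     qg (saturate u) i \<le> eta G i * pg (saturate u) i \<and>
     kg (saturate u) i \<in> {0, 1} \<and> kc (saturate u) i \<in> {0, 1} \<and>
     (1 - kc (saturate u) i) * beta_min G i \<le> beta (saturate u) i \<and>
     beta (saturate u) i \<le> 1 - kc (saturate u) i"
    by (simp add: mult.assoc)
qed

text \<open>A disrupted DG is already disconnected, as \<open>d i \<le> kg u i\<close>, so
  saturation leaves it at zero output.\<close>

lemma saturate_in_responses_under:
  assumes "u \<in> responses_under G d"
  shows "saturate u \<in> responses_under G d"
  using assms saturate_in_responses pg_max_nonneg
  unfolding responses_under_def by (auto intro: mult_left_mono)

text \<open>Disconnected DGs inject nothing, so the saturated injections are bounded by those in
  \<open>nrpf_at_max_dg\<close>, and subtree consumption can only be larger.\<close>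

lemma nrpf_saturate:
  assumes "u \<in> responses G" "nrpf_at_max_dg G u"
  shows "nrpf G (\<lambda>i. beta u i * pc_nom G i - pg (saturate u) i)
                (\<lambda>i. beta u i * qc_nom G i - qg (saturate u) i)"
  unfolding nrpf_def
proof (intro ballI conjI)
  fix i assume i: "i \<in> N"
  have max: "0 \<le> (\<Sum>j\<in>subtree G i. beta u j * pc_nom G j - pg_max G j)"
    "0 \<le> (\<Sum>j\<in>subtree G i. beta u j * qc_nom G j - eta G j * pg_max G j)"
    using assms(2) i unfolding nrpf_at_max_dg_def nrpf_def by blast+
  have le: "pg (saturate u) j \<le> pg_max G j" "qg (saturate u) j \<le> eta G j * pg_max G j"
    if "j \<in> subtree G i" for j
  proof -
    have j: "j \<in> N" using that subtree_nodes by blast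
    then have "kg u j \<in> {0, 1}" using assms(1) unfolding responses_def by blast
    then show "pg (saturate u) j \<le> pg_max G j" "qg (saturate u) j \<le> eta G j * pg_max G j"
      using pg_max_nonneg[OF j] eta_nonneg[OF j] by auto
  qed
  show "0 \<le> (\<Sum>j\<in>subtree G i. beta u j * pc_nom G j - pg (saturate u) j)"
    by (rule order_trans[OF max(1)], rule sum_mono) (use le(1) in simp)
  show "0 \<le> (\<Sum>j\<in>subtree G i. beta u j * qc_nom G j - qg (saturate u) j)"
    by (rule order_trans[OF max(2)], rule sum_mono) (use le(2) in simp)
qed

text \<open>The fields \<open>pc\<close> and \<open>qc\<close> are kept because saturation does not
  change the loads.\<close>

definition set_flow where
  "set_flow u l P Q v x = x\<lparr>net_p := \<lambda>i. beta u i * pc_nom G i - pg (saturate u) i,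
     net_q := \<lambda>i. beta u i * qc_nom G i - qg (saturate u) i,
     ell := l, flow_P := P, flow_Q := Q, nu := v\<rparr>"

text \<open>Lower voltage bounds survive because voltages rise. Upper bounds hold because no voltage
  exceeds that of the substation, which respects them; the connection variables are
  nonnegative.\<close>

lemma common_state_raise:
  assumes x: "common_state G u x"
    and root: "v (root G) = nu x (root G)"
    and v: "\<And>j. j \<in> insert (root G) N \<Longrightarrow> nu x j \<le> v j \<and> v j \<le> nu x (root G)"
    and u: "u \<in> responses G"
    and l: "\<And>e. e \<in> E \<Longrightarrow> 0 \<le> l e"
  shows "common_state G (saturate u) (set_flow u l P Q v x)"
proof -
  have "nu_nom G - nu_drop G \<le> vc_hi G i" "nu_nom G - nu_drop G \<le> vg_hi G i" if "i \<in> N" for i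
    using network that unfolding distribution_network_def by blast+
  moreover have "0 \<le> kc u i" "0 \<le> kg u i" if "i \<in> N" for i
    using u that unfolding responses_def by force+
  ultimately show ?thesis
    using x v root l unfolding common_state_def set_flow_def by (auto; fastforce)
qed

section \<open>Comparison of losses and improved power flow states\<close>

lemma lpf_loss_le:
  assumes "\<And>i. i \<in> N \<Longrightarrow> nu x i \<le> nu x' i \<and> nu x' i \<le> nu_nom G"
  shows "lpf_loss G (saturate u) x' \<le> lpf_loss G u x"
proof -
  have "\<bar>nu_nom G - nu x' i\<bar> \<le> Max ((\<lambda>i. \<bar>nu_nom G - nu x i\<bar>) ` N)" if "i \<in> N" for i
  proof -
    have "\<bar>nu_nom G - nu x' i\<bar> \<le> \<bar>nu_nom G - nu x i\<bar>" using assms[OF that] by linarith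
    also have "\<dots> \<le> Max ((\<lambda>i. \<bar>nu_nom G - nu x i\<bar>) ` N)" using that finite_nodes by simp
    finally show ?thesis .
  qed
  then have "Max ((\<lambda>i. \<bar>nu_nom G - nu x' i\<bar>) ` N) \<le> Max ((\<lambda>i. \<bar>nu_nom G - nu x i\<bar>) ` N)"
    using finite_nodes nodes_nonempty by (intro Max.boundedI) auto
  then show ?thesis
    using network unfolding lpf_loss_def distribution_network_def by (simp add: mult_left_mono)
qed

text \<open>All deviations are measured from below \<open>nu_nom\<close>, and each one shrinks
  strictly, so their maximum over the finite node set does too. The load terms agree because
  \<open>beta\<close> and \<open>kc\<close> are kept.\<close>

lemma lpf_loss_less:
  assumes "\<And>i. i \<in> N \<Longrightarrow> nu x i < nu x' i \<and> nu x' i \<le> nu_nom G" and "0 < W_VR G"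
  shows "lpf_loss G (saturate u) x' < lpf_loss G u x"
proof -
  have "\<bar>nu_nom G - nu x' i\<bar> < Max ((\<lambda>i. \<bar>nu_nom G - nu x i\<bar>) ` N)" if "i \<in> N" for i
  proof -
    have "\<bar>nu_nom G - nu x' i\<bar> < \<bar>nu_nom G - nu x i\<bar>" using assms(1)[OF that] by linarith
    also have "\<dots> \<le> Max ((\<lambda>i. \<bar>nu_nom G - nu x i\<bar>) ` N)" using that finite_nodes by simp
    finally show ?thesis .
  qed
  then have "Max ((\<lambda>i. \<bar>nu_nom G - nu x' i\<bar>) ` N) < Max ((\<lambda>i. \<bar>nu_nom G - nu x i\<bar>) ` N)"
    using finite_nodes nodes_nonempty by (subst Max_less_iff) auto
  then show ?thesis using assms(2) unfolding lpf_loss_def by simp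
qed

text \<open>Nonnegativity of the new flows turns the bounds on flows into bounds on their squares,
  as the current constraint requires. The bound by \<open>nu_nom\<close> makes higher voltages count
  as smaller deviations.\<close>

definition improves where
  "improves x x' \<longleftrightarrow>
     (\<forall>e\<in>E. 0 \<le> flow_P x' e \<and> flow_P x' e \<le> flow_P x e \<and>
            0 \<le> flow_Q x' e \<and> flow_Q x' e \<le> flow_Q x e) \<and>
     (\<forall>j\<in>insert (root G) N. nu x j \<le> nu x' j \<and> nu x' j \<le> nu_nom G)"

text \<open>The current \<open>m\<close> stored in the new state is separate from the current
  \<open>l'\<close> in the flow equations. NPF takes them equal; for LPF \<open>l'\<close> is zero
  and \<open>m\<close> is chosen only after \<open>P\<close>, \<open>Q\<close> and \<open>v\<close>
  are known, hence the quantifier over \<open>m\<close>.\<close>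

lemma common_flow_improve:
  assumes common: "common_state G u x"
    and flow: "branch_flow G (net_p x) (net_q x) l (flow_P x) (flow_Q x) (nu x)"
    and u: "u \<in> responses G" "nrpf_at_max_dg G u"
    and l: "\<And>e. e \<in> E \<Longrightarrow> 0 \<le> l' e" "\<And>e. e \<in> E \<Longrightarrow> l' e \<le> l e"
  obtains P Q v where
    "\<And>m. (\<And>e. e \<in> E \<Longrightarrow> 0 \<le> m e) \<Longrightarrow> common_state G (saturate u) (set_flow u m P Q v x)"
    "\<And>m. branch_flow G (net_p (set_flow u m P Q v x)) (net_q (set_flow u m P Q v x)) l' P Q v"
    "\<And>m. improves x (set_flow u m P Q v x)"
    "\<And>a b i. (a, b) \<in> E \<Longrightarrow> (b, i) \<in> E\<^sup>* \<Longrightarrow>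
       pg u i \<noteq> pg (saturate u) i \<or> qg u i \<noteq> qg (saturate u) i \<Longrightarrow>
       (P (a, b) < flow_P x (a, b) \<or> Q (a, b) < flow_Q x (a, b)) \<and>
       (\<forall>j. (b, j) \<in> E\<^sup>* \<longrightarrow> nu x j < v j)"
proof -
  let ?p = "\<lambda>i. beta u i * pc_nom G i - pg (saturate u) i"
  let ?q = "\<lambda>i. beta u i * qc_nom G i - qg (saturate u) i"
  have net: "net_p x i = beta u i * pc_nom G i - pg u i"
    "net_q x i = beta u i * qc_nom G i - qg u i" if "i \<in> N" for i
    using common that unfolding common_state_def by auto
  have p: "?p i \<le> net_p x i" and q: "?q i \<le> net_q x i" if "i \<in> N" for i
    using saturate_ge[OF u(1) that] net[OF that] by linarith+
  have root: "nu x (root G) \<le> nu_nom G"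
    using common network unfolding common_state_def distribution_network_def by auto
  obtain P Q v where c: "branch_flow G ?p ?q l' P Q v"
    "v (root G) = nu x (root G)"
    "\<And>e. e \<in> E \<Longrightarrow> 0 \<le> P e \<and> P e \<le> flow_P x e \<and> 0 \<le> Q e \<and> Q e \<le> flow_Q x e"
    "\<And>j. j \<in> insert (root G) N \<Longrightarrow> nu x j \<le> v j \<and> v j \<le> nu x (root G)"
    and strict: "\<And>a b i. (a, b) \<in> E \<Longrightarrow> (b, i) \<in> E\<^sup>* \<Longrightarrow> ?p i < net_p x i \<or> ?q i < net_q x i \<Longrightarrow>
       (P (a, b) < flow_P x (a, b) \<or> Q (a, b) < flow_Q x (a, b)) \<and>
       (\<forall>j. (b, j) \<in> E\<^sup>* \<longrightarrow> nu x j < v j)"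
    using branch_flow_compare[OF flow p q l nrpf_saturate[OF u]] by blast
  show thesis
  proof (rule that[of P Q v])
    show "common_state G (saturate u) (set_flow u m P Q v x)" if "\<And>e. e \<in> E \<Longrightarrow> 0 \<le> m e" for m
      by (rule common_state_raise[OF common c(2) c(4) u(1) that])
    show "branch_flow G (net_p (set_flow u m P Q v x)) (net_q (set_flow u m P Q v x)) l' P Q v" for m
      using c(1) by (simp add: set_flow_def)
    show "improves x (set_flow u m P Q v x)" for m
      using c(3,4) root unfolding improves_def set_flow_def by force
    show "(P (a, b) < flow_P x (a, b) \<or> Q (a, b) < flow_Q x (a, b)) \<and>
       (\<forall>j. (b, j) \<in> E\<^sup>* \<longrightarrow> nu x j < v j)"
      if e: "(a, b) \<in> E" "(b, i) \<in> E\<^sup>*"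
        and ne: "pg u i \<noteq> pg (saturate u) i \<or> qg u i \<noteq> qg (saturate u) i" for a b i
    proof (rule strict[OF e])
      have i: "i \<in> N" using reach_node e edge_target by blast
      show "?p i < net_p x i \<or> ?q i < net_q x i"
        using saturate_ge[OF u(1) i] net[OF i] ne by linarith
    qed
  qed
qed

text \<open>Any smaller current that still satisfies the cone with the old flows and voltages also
  satisfies it with the new ones, whose flows are smaller and voltages higher. The lemma serves both
  to raise DG output at fixed current and to lower a current afterwards.\<close>

lemma npf_improve:
  assumes x: "x \<in> npf_states G u"
    and u: "u \<in> responses G" "nrpf_at_max_dg G u"
    and l: "\<And>e. e \<in> E \<Longrightarrow> 0 \<le> l e" "\<And>e. e \<in> E \<Longrightarrow> l e \<le> ell x e"
    and cone: "\<And>i j. (i, j) \<in> E \<Longrightarrow> (flow_P x (i, j))\<^sup>2 + (flow_Q x (i, j))\<^sup>2 \<le> l (i, j) * nu x i"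
  obtains x' where "x' \<in> npf_states G (saturate u)" "ell x' = l" "improves x x'"
    "\<And>a b i. (a, b) \<in> E \<Longrightarrow> (b, i) \<in> E\<^sup>* \<Longrightarrow>
       pg u i \<noteq> pg (saturate u) i \<or> qg u i \<noteq> qg (saturate u) i \<Longrightarrow>
       (flow_P x' (a, b) < flow_P x (a, b) \<or> flow_Q x' (a, b) < flow_Q x (a, b)) \<and>
       (\<forall>j. (b, j) \<in> E\<^sup>* \<longrightarrow> nu x j < nu x' j)"
proof -
  have common: "common_state G u x"
    and flow: "branch_flow G (net_p x) (net_q x) (ell x) (flow_P x) (flow_Q x) (nu x)"
    using x by (auto simp: npf_states_iff)
  from common_flow_improve[OF common flow u l]
  obtain P Q v where
    c: "\<And>m. (\<And>e. e \<in> E \<Longrightarrow> 0 \<le> m e) \<Longrightarrow> common_state G (saturate u) (set_flow u m P Q v x)"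
    "\<And>m. branch_flow G (net_p (set_flow u m P Q v x)) (net_q (set_flow u m P Q v x)) l P Q v"
    "\<And>m. improves x (set_flow u m P Q v x)"
    "\<And>a b i. (a, b) \<in> E \<Longrightarrow> (b, i) \<in> E\<^sup>* \<Longrightarrow>
       pg u i \<noteq> pg (saturate u) i \<or> qg u i \<noteq> qg (saturate u) i \<Longrightarrow>
       (P (a, b) < flow_P x (a, b) \<or> Q (a, b) < flow_Q x (a, b)) \<and>
       (\<forall>j. (b, j) \<in> E\<^sup>* \<longrightarrow> nu x j < v j)"
    by metis
  let ?x = "set_flow u l P Q v x"
  have [simp]: "ell ?x = l" "flow_P ?x = P" "flow_Q ?x = Q" "nu ?x = v"
    by (simp_all add: set_flow_def)
  have "(P (i, j))\<^sup>2 + (Q (i, j))\<^sup>2 \<le> l (i, j) * v i" if e: "(i, j) \<in> E" for i j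
  proof -
    have "i \<in> insert (root G) N" using e edges_subset by blast
    then have "nu x i \<le> v i" using c(3)[of l] unfolding improves_def by auto
    then have "l (i, j) * nu x i \<le> l (i, j) * v i" using l(1)[OF e] by (rule mult_left_mono)
    moreover have "(P (i, j))\<^sup>2 \<le> (flow_P x (i, j))\<^sup>2" "(Q (i, j))\<^sup>2 \<le> (flow_Q x (i, j))\<^sup>2"
      using c(3)[of l] e unfolding improves_def by (auto intro: power_mono)
    ultimately show ?thesis using cone[OF e] by linarith
  qed
  then have "?x \<in> npf_states G (saturate u)"
    using c(1)[OF l(1)] c(2) by (auto simp: npf_states_iff)
  then show thesis using that[of ?x] c(3,4) by simp
qed

text \<open>Currents do not enter the lossless flow equations, so they can be read off from the new
  flows and voltages at the end.\<close>

lemma lpf_improve: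
  assumes x: "x \<in> lpf_states G u"
    and u: "u \<in> responses G" "nrpf_at_max_dg G u"
  obtains x' where "x' \<in> lpf_states G (saturate u)" "improves x x'"
    "\<And>a b i. (a, b) \<in> E \<Longrightarrow> (b, i) \<in> E\<^sup>* \<Longrightarrow>
       pg u i \<noteq> pg (saturate u) i \<or> qg u i \<noteq> qg (saturate u) i \<Longrightarrow>
       (\<forall>j. (b, j) \<in> E\<^sup>* \<longrightarrow> nu x j < nu x' j)"
proof -
  have common: "common_state G u x"
    and flow: "branch_flow G (net_p x) (net_q x) (\<lambda>_. 0) (flow_P x) (flow_Q x) (nu x)"
    and current: "\<And>i j. (i, j) \<in> E \<Longrightarrow>
      ell x (i, j) * nu x i = (flow_P x (i, j))\<^sup>2 + (flow_Q x (i, j))\<^sup>2"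
    using x by (auto simp: lpf_states_iff)
  from common_flow_improve[OF common flow u, of "\<lambda>_. 0"]
  obtain P Q v where
    c: "\<And>m. (\<And>e. e \<in> E \<Longrightarrow> 0 \<le> m e) \<Longrightarrow> common_state G (saturate u) (set_flow u m P Q v x)"
    "\<And>m. branch_flow G (net_p (set_flow u m P Q v x)) (net_q (set_flow u m P Q v x)) (\<lambda>_. 0) P Q v"
    "\<And>m. improves x (set_flow u m P Q v x)"
    "\<And>a b i. (a, b) \<in> E \<Longrightarrow> (b, i) \<in> E\<^sup>* \<Longrightarrow>
       pg u i \<noteq> pg (saturate u) i \<or> qg u i \<noteq> qg (saturate u) i \<Longrightarrow>
       (P (a, b) < flow_P x (a, b) \<or> Q (a, b) < flow_Q x (a, b)) \<and>
       (\<forall>j. (b, j) \<in> E\<^sup>* \<longrightarrow> nu x j < v j)"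
    by (metis order_refl)
  define l where "l = (\<lambda>(i, j). ((P (i, j))\<^sup>2 + (Q (i, j))\<^sup>2) / v i)"
  let ?x = "set_flow u l P Q v x"
  have [simp]: "ell ?x = l" "flow_P ?x = P" "flow_Q ?x = Q" "nu ?x = v"
    by (simp_all add: set_flow_def)
  have v: "0 \<le> nu x i \<and> nu x i \<le> v i" if "(i, j) \<in> E" for i j
  proof -
    have "i \<in> insert (root G) N" using that edges_subset by blast
    then show ?thesis using common c(3)[of l] unfolding common_state_def improves_def by auto
  qed
  have l0: "0 \<le> l e" if "e \<in> E" for e
    using v[of "fst e" "snd e"] that unfolding l_def by (auto split: prod.split)
  \<comment> \<open>If \<open>v i = 0\<close> the quotient is the junk value 0, but then \<open>nu x i = 0\<close> forces both flows to vanish.\<close>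
  have "l (i, j) * v i = (P (i, j))\<^sup>2 + (Q (i, j))\<^sup>2" if e: "(i, j) \<in> E" for i j
  proof (cases "v i = 0")
    case True
    then have "nu x i = 0" using v[OF e] by simp
    then have "flow_P x (i, j) = 0 \<and> flow_Q x (i, j) = 0"
      using current[OF e] by (simp add: sum_power2_eq_zero_iff)
    then have "P (i, j) = 0 \<and> Q (i, j) = 0"
      using c(3)[of l] e unfolding improves_def by fastforce
    then show ?thesis using True by simp
  qed (simp add: l_def)
  then have "?x \<in> lpf_states G (saturate u)"
    using c(1)[OF l0] c(2) by (auto simp: lpf_states_iff)
  then show thesis using that[of ?x] c(3,4) by simp
qed

section \<open>Strict improvement and optimality\<close>

lemma not_dg_at_maxE:
  assumes "\<not> dg_at_max_output G u"
  obtains i where "i \<in> N" "pg u i \<noteq> pg (saturate u) i \<or> qg u i \<noteq> qg (saturate u) i"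
  using assms unfolding dg_at_max_output_def by auto

text \<open>Every path from the root to a node starts with the only line leaving the root.\<close>

lemma single_feeder_reaches:
  assumes "\<exists>!j. (root G, j) \<in> E"
  obtains b where "(root G, b) \<in> E" "\<And>j. j \<in> N \<Longrightarrow> (b, j) \<in> E\<^sup>*"
proof -
  obtain b where b: "(root G, b) \<in> E" using assms by blast
  have "(b, j) \<in> E\<^sup>*" if "j \<in> N" for j
    using root_reaches[OF that]
  proof (cases rule: converse_rtranclE)
    case base
    then show ?thesis using that root_not_node by blast
  next
    case (step k)
    then show ?thesis using assms b by blast
  qed
  with b show thesis by (rule that)
qed

lemma improves_lpf_loss_le: "improves x x' \<Longrightarrow> lpf_loss G (saturate u) x' \<le> lpf_loss G u x"
  by (rule lpf_loss_le) (auto simp: improves_def)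

lemma improves_lpf_loss_less:
  assumes "improves x x'" "voltage_sensitive G" "\<not> dg_at_max_output G u"
    and strict: "\<And>a b i. (a, b) \<in> E \<Longrightarrow> (b, i) \<in> E\<^sup>* \<Longrightarrow>
       pg u i \<noteq> pg (saturate u) i \<or> qg u i \<noteq> qg (saturate u) i \<Longrightarrow>
       (\<forall>j. (b, j) \<in> E\<^sup>* \<longrightarrow> nu x j < nu x' j)"
  shows "lpf_loss G (saturate u) x' < lpf_loss G u x"
proof -
  obtain i where i: "i \<in> N" "pg u i \<noteq> pg (saturate u) i \<or> qg u i \<noteq> qg (saturate u) i"
    using assms(3) by (rule not_dg_at_maxE)
  obtain b where b: "(root G, b) \<in> E" "\<And>j. j \<in> N \<Longrightarrow> (b, j) \<in> E\<^sup>*"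
    using assms(2) single_feeder_reaches unfolding voltage_sensitive_def by blast
  show ?thesis
    using strict[OF b(1) b(2)[OF i(1)] i(2)] b(2) assms(1,2)
    by (intro lpf_loss_less) (auto simp: improves_def voltage_sensitive_def)
qed

text \<open>If voltages matter, saturation at unchanged currents already suffices. Otherwise a
  second step lowers the current on a line whose constraint has become slack; this reduces line
  losses and does not raise the other terms.\<close>

lemma npf_strictly_improvable:
  assumes x: "x \<in> npf_states G u"
    and u: "u \<in> responses G" "nrpf_at_max_dg G u" "\<not> dg_at_max_output G u"
    and W: "0 < W_LL G \<or> voltage_sensitive G"
  shows "\<exists>x'\<in>npf_states G (saturate u). npf_loss G (saturate u) x' < npf_loss G u x"
proof -
  have cone: "(flow_P x (i, j))\<^sup>2 + (flow_Q x (i, j))\<^sup>2 \<le> ell x (i, j) * nu x i"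
    if "(i, j) \<in> E" for i j using x that by (auto simp: npf_states_iff)
  have ell0: "0 \<le> ell x e" if "e \<in> E" for e
    using x that by (auto simp: npf_states_iff common_state_def)
  obtain y where y: "y \<in> npf_states G (saturate u)" "ell y = ell x" "improves x y"
    and strict: "\<And>a b i. (a, b) \<in> E \<Longrightarrow> (b, i) \<in> E\<^sup>* \<Longrightarrow>
       pg u i \<noteq> pg (saturate u) i \<or> qg u i \<noteq> qg (saturate u) i \<Longrightarrow>
       (flow_P y (a, b) < flow_P x (a, b) \<or> flow_Q y (a, b) < flow_Q x (a, b)) \<and>
       (\<forall>j. (b, j) \<in> E\<^sup>* \<longrightarrow> nu x j < nu y j)"
    using npf_improve[OF x u(1,2) ell0 order_refl cone] by metis
  show ?thesis
  proof (cases "voltage_sensitive G")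
    case True
    then have "lpf_loss G (saturate u) y < lpf_loss G u x"
      using improves_lpf_loss_less[OF y(3) _ u(3)] strict by blast
    then have "npf_loss G (saturate u) y < npf_loss G u x" by (simp add: npf_loss_def y(2))
    then show ?thesis using y(1) by blast
  next
    case False
    then have W_LL: "0 < W_LL G" using W by blast
    obtain i where i: "i \<in> N" "pg u i \<noteq> pg (saturate u) i \<or> qg u i \<noteq> qg (saturate u) i"
      using u(3) by (rule not_dg_at_maxE)
    let ?a = "parent i"
    let ?s = "(flow_P y (?a, i))\<^sup>2 + (flow_Q y (?a, i))\<^sup>2"
    note e = parent_edge[OF i(1)]
    have a: "?a \<in> insert (root G) N" using e edges_subset by blast
    have less: "flow_P y (?a, i) < flow_P x (?a, i) \<or> flow_Q y (?a, i) < flow_Q x (?a, i)"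
      using strict[OF e rtrancl.rtrancl_refl i(2)] by blast
    have bnd: "0 \<le> flow_P y (?a, i)" "flow_P y (?a, i) \<le> flow_P x (?a, i)"
      "0 \<le> flow_Q y (?a, i)" "flow_Q y (?a, i) \<le> flow_Q x (?a, i)"
      and nu: "nu x ?a \<le> nu y ?a"
      using y(3) e a unfolding improves_def by blast+
    have "?s < (flow_P x (?a, i))\<^sup>2 + (flow_Q x (?a, i))\<^sup>2"
      using less bnd power_mono[OF bnd(2,1), of 2] power_mono[OF bnd(4,3), of 2]
        power_strict_mono[OF _ bnd(1), of _ 2] power_strict_mono[OF _ bnd(3), of _ 2]
      by (fastforce intro: add_less_le_mono add_le_less_mono)
    also have "\<dots> \<le> ell x (?a, i) * nu x ?a" by (rule cone[OF e])
    also have "\<dots> \<le> ell x (?a, i) * nu y ?a" using nu ell0[OF e] by (rule mult_left_mono)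
    finally have slack: "?s < ell x (?a, i) * nu y ?a" .
    \<comment> \<open>The strict slack forces the voltage at \<open>?a\<close> to be positive, so it
      may be divided by.\<close>
    have "0 \<le> ?s" by simp
    then have "0 < ell x (?a, i) * nu y ?a" using slack by linarith
    then have nu_pos: "0 < nu y ?a" using ell0[OF e] by (auto simp: zero_less_mult_iff)
    \<comment> \<open>The new value is the smallest current that the flows and voltage of
      \<open>y\<close> admit on this line.\<close>
    define l where "l = (ell x)((?a, i) := ?s / nu y ?a)"
    have drop: "l (?a, i) < ell x (?a, i)"
      using slack nu_pos by (simp add: l_def pos_divide_less_eq)
    have l_le: "l e \<le> ell x e" for e using drop by (cases "e = (?a, i)") (auto simp: l_def)
    have l0: "0 \<le> l e" if "e \<in> E" for e using ell0[OF that] nu_pos by (auto simp: l_def)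
    have y_cone: "(flow_P y (j, k))\<^sup>2 + (flow_Q y (j, k))\<^sup>2 \<le> l (j, k) * nu y j"
      if "(j, k) \<in> E" for j k
      using y(1,2) that nu_pos by (auto simp: npf_states_iff l_def)
    \<comment> \<open>The improvement is applied a second time, now to \<open>saturate u\<close>.
      Saturation is idempotent, so the response stays the same and only the state changes.\<close>
    have sat: "saturate u \<in> responses G" "nrpf_at_max_dg G (saturate u)"
      using saturate_in_responses u(1,2) by (auto simp: nrpf_at_max_dg_def)
    obtain z where z: "z \<in> npf_states G (saturate u)" "ell z = l" "improves y z"
      using npf_improve[OF y(1) sat l0 _ y_cone] l_le y(2) by (metis saturate_simps(6))
    have "lpf_loss G (saturate u) z \<le> lpf_loss G u x"
      using improves_lpf_loss_le[OF y(3), of u] improves_lpf_loss_le[OF z(3), of "saturate u"] by simp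
    moreover have "(\<Sum>e\<in>E. resist G e * ell z e) < (\<Sum>e\<in>E. resist G e * ell x e)"
    proof (rule sum_strict_mono_ex1[OF finite_edges])
      show "\<forall>e\<in>E. resist G e * ell z e \<le> resist G e * ell x e"
        using l_le resist_pos by (simp add: z(2))
      show "\<exists>e\<in>E. resist G e * ell z e < resist G e * ell x e"
        using drop e resist_pos by (auto simp: z(2))
    qed
    ultimately have "npf_loss G (saturate u) z < npf_loss G u x"
      using W_LL unfolding npf_loss_def by (simp add: add_le_less_mono)
    then show ?thesis using z(1) by blast
  qed
qed

text \<open>Saturation is feasible and does not increase the loss, so it preserves optimality. Where
  it would lower the loss strictly, an optimal response must already be saturated.\<close>

lemma npf_optimal_saturate:
  assumes opt: "npf_optimal G d u" and nrpf: "nrpf_at_max_dg G u"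
  shows "npf_optimal G d (saturate u)"
    and "0 < W_LL G \<or> voltage_sensitive G \<Longrightarrow> dg_at_max_output G u"
proof -
  obtain x where u: "u \<in> responses_under G d" and x: "x \<in> npf_states G u"
    and best: "\<And>u' x'. u' \<in> responses_under G d \<Longrightarrow> x' \<in> npf_states G u' \<Longrightarrow>
      npf_loss G u x \<le> npf_loss G u' x'"
    using opt unfolding npf_optimal_def by blast
  have resp: "u \<in> responses G" using u unfolding responses_under_def by blast
  note sat = saturate_in_responses_under[OF u]
  have cone: "(flow_P x (i, j))\<^sup>2 + (flow_Q x (i, j))\<^sup>2 \<le> ell x (i, j) * nu x i"
    if "(i, j) \<in> E" for i j using x that by (auto simp: npf_states_iff)
  have ell0: "0 \<le> ell x e" if "e \<in> E" for e
    using x that by (auto simp: npf_states_iff common_state_def)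
  obtain y where y: "y \<in> npf_states G (saturate u)" "ell y = ell x" "improves x y"
    using npf_improve[OF x resp nrpf ell0 order_refl cone] by metis
  have "npf_loss G (saturate u) y \<le> npf_loss G u x"
    using improves_lpf_loss_le[OF y(3)] y(2) unfolding npf_loss_def by simp
  then show "npf_optimal G d (saturate u)"
    unfolding npf_optimal_def using sat y(1) best order_trans by blast
  show "dg_at_max_output G u" if "0 < W_LL G \<or> voltage_sensitive G"
    using npf_strictly_improvable[OF x resp nrpf _ that] best[OF sat] by fastforce
qed

text \<open>The LPF objective has no line-loss term, so strictness comes from voltage regulation
  alone.\<close>

lemma lpf_optimal_saturate:
  assumes opt: "lpf_optimal G d u" and nrpf: "nrpf_at_max_dg G u"
  shows "lpf_optimal G d (saturate u)"
    and "voltage_sensitive G \<Longrightarrow> dg_at_max_output G u"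
proof -
  obtain x where u: "u \<in> responses_under G d" and x: "x \<in> lpf_states G u"
    and best: "\<And>u' x'. u' \<in> responses_under G d \<Longrightarrow> x' \<in> lpf_states G u' \<Longrightarrow>
      lpf_loss G u x \<le> lpf_loss G u' x'"
    using opt unfolding lpf_optimal_def by blast
  have resp: "u \<in> responses G" using u unfolding responses_under_def by blast
  note sat = saturate_in_responses_under[OF u]
  obtain y where y: "y \<in> lpf_states G (saturate u)" "improves x y"
    and strict: "\<And>a b i. (a, b) \<in> E \<Longrightarrow> (b, i) \<in> E\<^sup>* \<Longrightarrow>
       pg u i \<noteq> pg (saturate u) i \<or> qg u i \<noteq> qg (saturate u) i \<Longrightarrow>
       (\<forall>j. (b, j) \<in> E\<^sup>* \<longrightarrow> nu x j < nu y j)"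
    using lpf_improve[OF x resp nrpf] by metis
  show "lpf_optimal G d (saturate u)"
    unfolding lpf_optimal_def using sat y(1) best improves_lpf_loss_le[OF y(2)] order_trans by blast
  show "dg_at_max_output G u" if "voltage_sensitive G"
    using improves_lpf_loss_less[OF y(2) that _ strict] best[OF sat y(1)] by fastforce
qed

end

text \<open>The witness is \<open>saturate u\<close> in both models. Responses that differ only in
  DG output may tie in loss, so existence is stated in general, and maximality of every optimum
  under conditions that exclude such ties.\<close>

theorem proposition2:
  fixes G :: "'a network" and k :: nat and d :: "'a \<Rightarrow> real"
  assumes "distribution_network G"
    and "d \<in> attacks G k"
  shows "(\<forall>u. npf_optimal G d u \<and> nrpf_at_max_dg G u \<longrightarrow>
            (\<exists>u'. npf_optimal G d u' \<and> beta u' = beta u \<and> kc u' = kc u \<and> kg u' = kg u \<and>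
                  dg_at_max_output G u') \<and>
            (0 < W_LL G \<or> voltage_sensitive G \<longrightarrow> dg_at_max_output G u)) \<and>
         (\<forall>u. lpf_optimal G d u \<and> nrpf_at_max_dg G u \<longrightarrow>
            (\<exists>u'. lpf_optimal G d u' \<and> beta u' = beta u \<and> kc u' = kc u \<and> kg u' = kg u \<and>
                  dg_at_max_output G u') \<and>
            (voltage_sensitive G \<longrightarrow> dg_at_max_output G u))"
proof -
  interpret radial_network G using assms(1) by unfold_locales
  show ?thesis
    by (metis npf_optimal_saturate lpf_optimal_saturate dg_at_max_saturate saturate_simps(1-3))
qed

end
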